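(* Let $\mu$ be a continuous probability distribution on $\mathbb{R}^d$ that is a doubling measure of dimension $d_o\ge2$ with respect to a subset $\mathcal{X}\subseteq\mathbb{R}^d$. Pick any $q\in\mathcal{X}$ and draw $x_1,\ldots,x_n$ independently at random from $\mu$. Let $0<\delta<1/2$. Then with probability at least $1-3\delta$ over the choice of the $x_i$, for all $2\le m\le n$, $$\Phi_m(q,\{x_1,\ldots,x_n\})\ \le\ 6\left(\frac2m\ln\frac1\delta\right)^{1/d_o}.$$
   Context: $\mu$ is a doubling measure of dimension $d_o$ with respect to $\mathcal{X}$ if $\mu(B(x,2r))\le C\,\mu(B(x,r))$ for all $x\in\mathcal{X}$ and all $r>0$, where $C=2^{d_o}$ and $B(x,r)$ is the closed Euclidean ball of radius $r$ centered at $x$. $x_{(1)},\ldots,x_{(n)}$ orders the data by increasing Euclidean distance from $q$, and $\Phi_m(q,\{x_1,\ldots,x_n\})=\frac1m\sum_{i=2}^m\frac{\|q-x_{(1)}\|}{\|q-x_{(i)}\|}$. *)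

theory Defs
  imports "HOL-Probability.Probability"
begin

text \<open>Atomless: the weakest usual sense of a continuous distribution. In particular it does not
  require a density with respect to Lebesgue measure, so that distributions concentrated on
  lower-dimensional sets are covered.\<close>

definition continuous_distribution :: "'a::euclidean_space measure \<Rightarrow> bool" where
  "continuous_distribution \<mu> \<longleftrightarrow>
     prob_space \<mu> \<and> sets \<mu> = sets borel \<and> (\<forall>x. measure \<mu> {x} = 0)"

definition doubling_measure :: "'a::euclidean_space measure \<Rightarrow> real \<Rightarrow> 'a set \<Rightarrow> bool" where
  "doubling_measure \<mu> d\<^sub>o \<X> \<longleftrightarrow>
     (\<forall>x\<in>\<X>. \<forall>r>0. measure \<mu> (cball x (2 * r)) \<le> 2 powr d\<^sub>o * measure \<mu> (cball x r))"

text \<open>The data are a list, i.e. counted with multiplicity. \<open>nth_nearest q xs i\<close> is the point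
  $x_{(i)}$, counting from 1; it is meaningful for \<open>1 \<le> i \<le> length xs\<close>. Ties in the distance
  are resolved by the position in the list, which does not influence \<open>\<Phi>\<close>.\<close>

definition nth_nearest :: "'a::euclidean_space \<Rightarrow> 'a list \<Rightarrow> nat \<Rightarrow> 'a" where
  "nth_nearest q xs i = sort_key (\<lambda>x. norm (q - x)) xs ! (i - 1)"

definition \<Phi> :: "nat \<Rightarrow> 'a::euclidean_space \<Rightarrow> 'a list \<Rightarrow> real" where
  "\<Phi> m q xs =
     1 / real m * (\<Sum>i=2..m. norm (q - nth_nearest q xs 1) / norm (q - nth_nearest q xs i))"

end

theory Submission
  imports Defs
begin

text \<open>
  Write \<open>L = ln (1/\<delta>)\<close> and let \<open>R\<^sub>i\<close> be the distance from \<open>q\<close> to its \<open>i\<close>-th nearest sample point.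
  Iterating the doubling condition bounds \<open>R\<^sub>1 / R\<^sub>i\<close> by twice the \<open>1/d\<^sub>o\<close>-th power of the mass of the
  open ball of radius \<open>R\<^sub>1\<close> over the mass of the closed ball of radius \<open>R\<^sub>i\<close>. Choose radii at the
  quantiles of the radial law. With probability at least \<open>1 - \<delta>\<close> some point lies within the quantile
  radius of level \<open>L/n\<close>, so the numerator is at most \<open>L/n\<close>. A Chernoff bound for the number of points
  inside the quantile radius of level \<open>i/(2n)\<close>, summed over \<open>i > 24 L\<close>, shows that with probability
  at least \<open>1 - 2\<delta>\<close> the denominator is at least \<open>i/(2n)\<close> for all these \<open>i\<close>. The at most
  \<open>24 L\<close> remaining terms of the average are bounded by 1, which is affordable because the
  claim is trivial unless its right-hand side is below 1.
\<close>

section \<open>Distances from \<open>q\<close>: order statistics and quantiles\<close>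

text \<open>In a sorted list the entries with key at most \<open>t\<close> form an initial segment,
  so a rank is compared with its length. \<open>i\<close> counts from 1, hence the index
  \<open>i - 1\<close>.\<close>

lemma nth_sorted_le_iff:
  fixes f :: "'a \<Rightarrow> real"
  assumes "sorted (map f ys)" "0 < i" "i \<le> length ys"
  shows "f (ys ! (i - 1)) \<le> t \<longleftrightarrow> i \<le> length (filter (\<lambda>y. f y \<le> t) ys)"
proof -
  let ?S = "{j. j < length ys \<and> f (ys ! j) \<le> t}"
  have mono: "f (ys ! j) \<le> f (ys ! k)" if "j \<le> k" "k < length ys" for j k
    using sorted_nth_mono[OF assms(1), of j k] that by simp
  show ?thesis
  proof
    assume "f (ys ! (i - 1)) \<le> t"
    moreover have "f (ys ! j) \<le> f (ys ! (i - 1))" if "j < i" for j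
      using that assms(3) by (intro mono) auto
    ultimately have "{..<i} \<subseteq> ?S"
      using assms(3) by (auto intro: order.trans)
    then have "card {..<i} \<le> card ?S"
      by (intro card_mono) auto
    then show "i \<le> length (filter (\<lambda>y. f y \<le> t) ys)"
      by (simp add: length_filter_conv_card)
  next
    assume *: "i \<le> length (filter (\<lambda>y. f y \<le> t) ys)"
    show "f (ys ! (i - 1)) \<le> t"
    proof (rule ccontr)
      assume "\<not> f (ys ! (i - 1)) \<le> t"
      then have "?S \<subseteq> {..<i - 1}"
        using mono[of "i - 1"] by (fastforce simp: not_le[symmetric] dest: order.trans)
      then have "card ?S \<le> card {..<i - 1}"
        by (intro card_mono) auto
      with * assms(2) show False
        by (simp add: length_filter_conv_card)
    qed
  qed
qed

text \<open>Sorting only permutes the list, so the count may be taken over sample indices. Events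
  about order statistics thereby become events about counts.\<close>

lemma norm_nth_nearest_le_iff:
  assumes "1 \<le> i" "i \<le> n"
  shows "norm (q - nth_nearest q (map x [1..<n + 1]) i) \<le> t
    \<longleftrightarrow> i \<le> card {j \<in> {1..n}. norm (q - x j) \<le> t}"
proof -
  let ?f = "\<lambda>y. norm (q - y)" and ?xs = "map x [1..<n + 1]"
  have "length (filter (\<lambda>y. ?f y \<le> t) (sort_key ?f ?xs)) = length (filter (\<lambda>y. ?f y \<le> t) ?xs)"
    by (metis mset_filter mset_sort size_mset)
  also have "\<dots> = length (filter (\<lambda>j. ?f (x j) \<le> t) [1..<n + 1])"
    by (simp only: filter_map length_map comp_def)
  also have "\<dots> = card ({j. ?f (x j) \<le> t} \<inter> set [1..<n + 1])"
    by (rule distinct_length_filter) simp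
  also have "{j. ?f (x j) \<le> t} \<inter> set [1..<n + 1] = {j \<in> {1..n}. ?f (x j) \<le> t}"
    by auto
  finally show ?thesis
    unfolding nth_nearest_def using assms
    by (subst nth_sorted_le_iff) auto
qed

lemma borel_measurable_norm_nth_nearest:
  fixes M :: "'a::euclidean_space measure"
  assumes [measurable_cong]: "sets M = sets borel" and "1 \<le> i" "i \<le> n"
  shows "(\<lambda>x. norm (q - nth_nearest q (map x [1..<n + 1]) i))
    \<in> borel_measurable (Pi\<^sub>M {1..n} (\<lambda>_. M))"
proof (subst borel_measurable_iff_le, intro allI)
  fix t
  \<comment> \<open>Written as a finite sum of indicators, the count is visibly measurable in
    \<open>x\<close>.\<close>
  have "real (card {j \<in> {1..n}. norm (q - x j) \<le> t})
      = (\<Sum>j\<in>{1..n}. if norm (q - x j) \<le> t then 1 else 0)" for x :: "nat \<Rightarrow> 'a"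
    by (simp add: sum.If_cases Int_def)
  then have "{x \<in> space (Pi\<^sub>M {1..n} (\<lambda>_. M)).
        norm (q - nth_nearest q (map x [1..<n + 1]) i) \<le> t}
      = {x \<in> space (Pi\<^sub>M {1..n} (\<lambda>_. M)).
        real i \<le> (\<Sum>j\<in>{1..n}. if norm (q - x j) \<le> t then 1 else 0)}"
    using assms(2,3) by (simp only: norm_nth_nearest_le_iff flip: of_nat_le_iff[where 'a = real])
  also have "\<dots> \<in> sets (Pi\<^sub>M {1..n} (\<lambda>_. M))"
    by measurable
  finally show "{x \<in> space (Pi\<^sub>M {1..n} (\<lambda>_. M)).
    norm (q - nth_nearest q (map x [1..<n + 1]) i) \<le> t} \<in> sets (Pi\<^sub>M {1..n} (\<lambda>_. M))" .
qed

text \<open>The radial law may have atoms (charged spheres), which is why both an open and a closed ball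
  occur here and in \<open>doubling_ratio_bound\<close>.\<close>

lemma quantile_radius:
  fixes M :: "'a::euclidean_space measure"
  assumes "prob_space M" and sets_M [measurable_cong]: "sets M = sets borel" and "0 < t" "t < 1"
  obtains s where "measure M (ball q s) \<le> t" "t \<le> measure M (cball q s)"
proof -
  interpret prob_space M by fact
  have [measurable]: "dist q \<in> borel_measurable M"
    by measurable
  interpret D: cdf_distribution "distr M borel (dist q)"
    unfolding cdf_distribution_def by (rule real_distribution_distr) measurable
  \<comment> \<open>\<open>D.I\<close> is the generalized inverse of the radial distribution
    function: for levels strictly between 0 and 1, \<open>D.I t \<le> r\<close> iff
    \<open>t \<le> D.C r\<close>.\<close>
  define s where "s = D.I t"
  have sp: "space M = UNIV"
    using sets_eq_imp_space_eq[OF sets_M] by simp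
  have cball: "D.C r = measure M (cball q r)" for r
    by (subst cdf_def2, subst measure_distr) (auto simp: sp vimage_def cball_def intro: arg_cong)
  have ball: "measure (distr M borel (dist q)) {..<r} = measure M (ball q r)" for r
    by (subst measure_distr) (auto simp: sp vimage_def ball_def)
  have "t \<le> D.C s"
    unfolding s_def using D.pseudoinverse[of t] assms by blast
  \<comment> \<open>The mass of the open ball is the left limit at \<open>s\<close>, and to the left
    of \<open>s\<close> the distribution function stays below \<open>t\<close>.\<close>
  moreover have "measure (distr M borel (dist q)) {..<s} \<le> t"
  proof (rule tendsto_upperbound[OF D.cdf_at_left])
    have "D.C r \<le> t" if "r < s" for r
      using D.pseudoinverse[of t r] assms that unfolding s_def by linarith
    then show "\<forall>\<^sub>F r in at_left s. D.C r \<le> t"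
      by (simp add: eventually_at_filter)
  qed simp
  ultimately show ?thesis
    using that[of s] by (simp add: cball ball)
qed

section \<open>Tail bounds for the number of sample points in a set\<close>

text \<open>Chernoff's method with base 2: independence factorizes the expectation of
  \<open>2 ^ N\<close>. Base 2 optimizes this form of bound when the threshold is twice the mean, as
  for quantile level \<open>i / (2 * n)\<close> and threshold \<open>i\<close>.\<close>

lemma prob_count_ge:
  assumes "prob_space M" and A [measurable]: "A \<in> sets M" and "finite I"
  shows "measure (Pi\<^sub>M I (\<lambda>_. M)) {x \<in> space (Pi\<^sub>M I (\<lambda>_. M)). k \<le> card {j \<in> I. x j \<in> A}}
    \<le> exp (card I * measure M A) / 2 ^ k"
proof -
  interpret prob_space M by fact
  interpret P: product_prob_space "\<lambda>_. M" I ..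
  let ?P = "Pi\<^sub>M I (\<lambda>_. M)"
  \<comment> \<open>Markov's inequality is applied to \<open>?u x = 2 ^ N\<close>, with \<open>N\<close> the number of points in \<open>A\<close>.\<close>
  let ?u = "\<lambda>x. \<Prod>j\<in>I. (1 + indicator A (x j)) :: real"
  have int: "integrable M (\<lambda>y. 1 + indicator A y :: real)"
    by (intro Bochner_Integration.integrable_add) (auto simp: integrable_indicator_iff emeasure_eq_measure)
  have u: "?u x = 2 ^ card {j \<in> I. x j \<in> A}" for x
  proof -
    have "?u x = (\<Prod>j\<in>I. if x j \<in> A then 2 else 1)"
      by (intro prod.cong) (auto simp: indicator_def)
    also have "\<dots> = 2 ^ card {j \<in> I. x j \<in> A}"
      using \<open>finite I\<close> by (simp add: prod.If_cases Int_def)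
    finally show ?thesis .
  qed
  have int_u: "integrable ?P ?u"
    using int \<open>finite I\<close> by (intro P.product_integrable_prod) auto
  have "{x \<in> space ?P. k \<le> card {j \<in> I. x j \<in> A}} = {x \<in> space ?P. 2 ^ k \<le> ?u x}"
    unfolding u by simp
  also have "measure ?P \<dots> \<le> (\<integral>x. ?u x \<partial>?P) / 2 ^ k"
    by (rule integral_Markov_inequality_measure[OF int_u, where A = "space ?P"])
       (auto intro!: AE_I2 prod_nonneg)
  also have "(\<integral>x. ?u x \<partial>?P) = (\<Prod>j\<in>I. \<integral>y. 1 + indicator A y \<partial>M)"
    using int \<open>finite I\<close> by (intro P.product_integral_prod) auto
  also have "\<dots> = (1 + measure M A) ^ card I"
    by (simp add: prob_space integrable_indicator_iff emeasure_eq_measure)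
  also have "\<dots> \<le> exp (measure M A) ^ card I"
    by (intro power_mono) (auto simp: add_nonneg_nonneg)
  finally show ?thesis
    by (simp add: exp_of_nat_mult divide_right_mono)
qed

lemma prob_none_in:
  assumes "prob_space M" and A [measurable]: "A \<in> sets M" and "finite I"
  shows "measure (Pi\<^sub>M I (\<lambda>_. M)) {x \<in> space (Pi\<^sub>M I (\<lambda>_. M)). \<forall>j\<in>I. x j \<notin> A}
    \<le> exp (- (card I * measure M A))"
proof -
  interpret prob_space M by fact
  interpret P: finite_product_prob_space "\<lambda>_. M" I
    by standard fact
  have "{x \<in> space (Pi\<^sub>M I (\<lambda>_. M)). \<forall>j\<in>I. x j \<notin> A} = (\<Pi>\<^sub>E j\<in>I. space M - A)"
    by (auto simp: space_PiM PiE_def Pi_def)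
  also have "P.prob \<dots> = (1 - measure M A) ^ card I"
    by (subst P.prob_times) (auto simp: prob_compl)
  also have "\<dots> \<le> exp (- measure M A) ^ card I"
    using exp_ge_add_one_self[of "- measure M A"] by (intro power_mono) auto
  finally show ?thesis
    by (simp flip: exp_of_nat_mult)
qed

section \<open>Radii versus masses under doubling\<close>

text \<open>Halve \<open>b\<close> until it drops below \<open>a\<close>. The factor
  \<open>(a / b) powr d\<close> pays for all halvings but the last, which costs
  \<open>2 powr d\<close>.\<close>

lemma doubling_ratio_bound:
  assumes "doubling_measure M d X" "q \<in> X" "0 < a" "a \<le> b"
    and "sets M = sets borel" "finite_measure M" "d \<ge> 0"
  shows "measure M (cball q b) * (a / b) powr d \<le> 2 powr d * measure M (ball q a)"
proof -
  interpret finite_measure M by fact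
  have cball_pow: "measure M (cball q (2 ^ k * r)) \<le> (2 powr d) ^ k * measure M (cball q r)"
    if "r > 0" for k r
  proof (induction k)
    case (Suc k)
    have "measure M (cball q (2 * (2 ^ k * r))) \<le> 2 powr d * measure M (cball q (2 ^ k * r))"
      using assms(1,2) that by (simp add: doubling_measure_def)
    also have "\<dots> \<le> 2 powr d * ((2 powr d) ^ k * measure M (cball q r))"
      using Suc by (intro mult_left_mono) auto
    finally show ?case
      by (simp add: algebra_simps)
  qed simp
  obtain N where N: "b / a < 2 ^ N"
    using real_arch_pow[of 2 "b / a"] by auto
  \<comment> \<open>The strict inequality puts the closed ball of radius \<open>b / 2 ^ k\<close>
    inside the open ball of radius \<open>a\<close>.\<close>
  define k where "k = (LEAST k. b / a < 2 ^ k)"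
  have k: "b / a < 2 ^ k"
    unfolding k_def by (rule LeastI[of _ N]) fact
  have "k \<noteq> 0"
    using k assms by (auto intro!: gr0I)
  then obtain j where j: "k = Suc j"
    by (cases k) auto
  have "\<not> b / a < 2 ^ j"
    using not_less_Least[of j "\<lambda>k. b / a < 2 ^ k"] j unfolding k_def by auto
  then have "a / b \<le> 1 / 2 ^ j"
    using assms by (simp add: field_simps)
  then have "(a / b) powr d \<le> (1 / 2 ^ j) powr d"
    using assms by (intro powr_mono2) auto
  also have "\<dots> = 1 / (2 powr d) ^ j"
    by (simp add: powr_divide powr_powr powr_power mult.commute flip: powr_realpow)
  finally have le: "(a / b) powr d \<le> 1 / (2 powr d) ^ j" .
  have "measure M (cball q b) = measure M (cball q (2 ^ k * (b / 2 ^ k)))"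
    by simp
  also have "\<dots> \<le> (2 powr d) ^ k * measure M (cball q (b / 2 ^ k))"
    using assms by (intro cball_pow) auto
  also have "\<dots> \<le> (2 powr d) ^ k * measure M (ball q a)"
    using k assms(3)
    by (intro mult_left_mono finite_measure_mono) (auto simp: assms(5) field_simps cball_subset_ball_iff)
  finally have "measure M (cball q b) * (a / b) powr d
      \<le> ((2 powr d) ^ k * measure M (ball q a)) * (1 / (2 powr d) ^ j)"
    using le by (intro mult_mono) auto
  also have "\<dots> = 2 powr d * measure M (ball q a)"
    by (simp add: j)
  finally show ?thesis .
qed

section \<open>Averaging the ratio bounds\<close>

text \<open>Each term is at most the increment of \<open>2 * sqrt\<close>, so the sum
  telescopes.\<close>

lemma sum_inverse_sqrt_le: "(\<Sum>i=1..m. 1 / sqrt (real i)) \<le> 2 * sqrt (real m)"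
proof (induction m)
  case (Suc m)
  let ?a = "sqrt (real m)" and ?b = "sqrt (real (Suc m))"
  have ab: "?b ^ 2 = ?a ^ 2 + 1" "?a \<le> ?b" "?a \<ge> 0" "?b > 0"
    by simp_all
  have "(?b - ?a)\<^sup>2 \<ge> 0" by simp
  then have "2 * ?a * ?b + 1 \<le> 2 * ?b * ?b"
    using ab(1) by (simp add: power2_eq_square algebra_simps)
  then have "2 * ?a + 1 / ?b \<le> 2 * ?b"
    using ab(4) by (simp add: field_simps)
  with Suc show ?case by simp
qed simp

text \<open>The constant 6 splits as 2 + 4: the terms with \<open>i \<le> 24 * L\<close> contribute
  at most \<open>2 * v * m\<close>, the others at most \<open>4 * v * m\<close>.\<close>

lemma average_ratio_bound:
  fixes R :: "nat \<Rightarrow> real" and d L :: real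
  assumes "d \<ge> 2" "L > 0" "m \<ge> 2"
    and nonneg: "\<And>i. R i \<ge> 0"
    and le: "\<And>i. i \<in> {2..m} \<Longrightarrow> R 1 \<le> R i"
    and ratio: "\<And>i. i \<in> {2..m} \<Longrightarrow> 24 * L < real i \<Longrightarrow> R 1 / R i \<le> 2 * (2 * L / real i) powr (1 / d)"
  shows "1 / real m * (\<Sum>i=2..m. R 1 / R i) \<le> 6 * (2 * L / real m) powr (1 / d)"
proof -
  define v where "v = (2 * L / real m) powr (1 / d)"
  \<comment> \<open>If \<open>R i = 0\<close>, the quotient is 0 by the convention for division by
    zero.\<close>
  have ratio_le_1: "R 1 / R i \<le> 1" if "i \<in> {2..m}" for i
    using le[OF that] nonneg[of i] by (cases "R i = 0") (auto simp: field_simps)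
  have v: "v > 0" "2 * L / real m = v powr d"
    using assms by (auto simp: v_def powr_powr)
  have m: "real m > 0"
    using assms by simp
  have "(\<Sum>i=2..m. R 1 / R i) \<le> 6 * v * m"
  proof (cases "6 * v \<ge> 1")
    case True
    have "(\<Sum>i=2..m. R 1 / R i) \<le> (\<Sum>i=2..m. 1)"
      by (intro sum_mono ratio_le_1)
    also have "\<dots> \<le> 1 * real m"
      by simp
    also have "\<dots> \<le> 6 * v * m"
      using True by (intro mult_right_mono) auto
    finally show ?thesis .
  next
    case False
    \<comment> \<open>Since \<open>v < 1/6\<close> and \<open>d \<ge> 2\<close>,
      \<open>2 * L / m = v powr d\<close> is at most \<open>v / 6\<close>; multiplying by
      \<open>12 * m\<close> bounds the number of small indices.\<close>
    have "v powr d \<le> v powr 2"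
      using False v assms by (intro powr_mono') auto
    also have "\<dots> = v * v"
      using v by (simp add: powr_numeral power2_eq_square)
    also have "\<dots> \<le> v * (1 / 6)"
      using False v by (intro mult_left_mono) auto
    finally have "2 * L / real m \<le> v / 6"
      by (simp add: v)
    then have head: "24 * L \<le> 2 * v * m"
      using m by (simp add: field_simps)
    have bound: "R 1 / R i \<le> (if real i \<le> 24 * L then 1 else 0) + 2 * v * (sqrt m * (1 / sqrt i))"
      if i: "i \<in> {2..m}" for i
    proof (cases "real i \<le> 24 * L")
      case True
      then show ?thesis
        using ratio_le_1[OF i] v by (simp add: add_increasing2)
    next
      case False
      have "(2 * L / real i) powr (1 / d) = v * (real m / real i) powr (1 / d)"
        using m i assms by (simp add: v_def flip: powr_mult)
      \<comment> \<open>As \<open>m / i \<ge> 1\<close> and \<open>d \<ge> 2\<close>, the exponent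
        \<open>1 / d\<close> may be raised to \<open>1 / 2\<close>, making the sum independent of
        \<open>d\<close>.\<close>
      also have "\<dots> \<le> v * (real m / real i) powr (1 / 2)"
        using m i v assms by (intro mult_left_mono powr_mono) (auto simp: field_simps)
      also have "\<dots> = v * (sqrt m * (1 / sqrt i))"
        by (simp add: powr_half_sqrt real_sqrt_divide)
      finally show ?thesis
        using ratio[OF i] False by simp
    qed
    have "(\<Sum>i=2..m. R 1 / R i)
        \<le> (\<Sum>i=2..m. (if real i \<le> 24 * L then 1 else 0) + 2 * v * (sqrt m * (1 / sqrt i)))"
      by (intro sum_mono bound)
    also have "\<dots> \<le> (\<Sum>i=1..m. (if real i \<le> 24 * L then 1 else 0) + 2 * v * (sqrt m * (1 / sqrt i)))"
      using v by (intro sum_mono2) auto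
    also have "\<dots> = real (card {i \<in> {1..m}. real i \<le> 24 * L})
        + 2 * v * sqrt m * (\<Sum>i=1..m. 1 / sqrt i)"
      by (simp add: sum.distrib sum.If_cases Int_def sum_distrib_left algebra_simps)
    also have "real (card {i \<in> {1..m}. real i \<le> 24 * L}) \<le> 24 * L"
    proof -
      have "{i \<in> {1..m}. real i \<le> 24 * L} \<subseteq> {1..nat \<lfloor>24 * L\<rfloor>}"
        by (auto simp: le_nat_floor)
      then have "card {i \<in> {1..m}. real i \<le> 24 * L} \<le> card {1..nat \<lfloor>24 * L\<rfloor>}"
        by (intro card_mono) auto
      then show ?thesis
        using assms by simp linarith
    qed
    also have "2 * v * sqrt m * (\<Sum>i=1..m. 1 / sqrt i) \<le> 2 * v * sqrt m * (2 * sqrt m)"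
      using v sum_inverse_sqrt_le[of m] by (intro mult_left_mono) auto
    also have "\<dots> = 4 * v * m"
      by simp
    finally show ?thesis
      using head by simp
  qed
  then have "1 / real m * (\<Sum>i=2..m. R 1 / R i) \<le> 1 / real m * (6 * v * m)"
    by (intro mult_left_mono) auto
  then show ?thesis
    using m by (simp add: v_def)
qed

section \<open>Total failure probability of the Chernoff bounds\<close>

text \<open>The ratio is below 5/6, and 24 = 8 * 3 makes the first power at most
  \<open>\<delta> ^ 3\<close>, because \<open>(6/5) ^ 8\<close> exceeds \<open>exp 1\<close>. The
  spare \<open>\<delta> ^ 2 < 1/4\<close> absorbs the factor 6 of the geometric series.\<close>

lemma geometric_tail_bound:
  fixes \<delta> :: real
  assumes "0 < \<delta>" "\<delta> < 1/2"
  shows "(\<Sum>i\<in>{i\<in>{1..n}. 24 * ln (1 / \<delta>) < real i}. (exp (1/2) / 2) ^ i) \<le> 2 * \<delta>"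
proof -
  define K where "K = nat \<lceil>24 * ln (1 / \<delta>)\<rceil>"
  have K: "24 * ln (1 / \<delta>) \<le> real K"
    unfolding K_def by linarith
  have "exp (1/2) ^ 2 = exp (1::real)"
    by (simp flip: exp_of_nat_mult)
  then have "exp (1/2) ^ 2 \<le> (5/3::real) ^ 2"
    using e_less_272 by (simp add: power2_eq_square)
  then have "exp (1/2) / 2 \<le> (5/6::real)"
    by (simp add: power2_le_iff_abs_le)
  then have "(\<Sum>i\<in>{i\<in>{1..n}. 24 * ln (1 / \<delta>) < real i}. (exp (1/2) / 2) ^ i)
      \<le> (\<Sum>i\<in>{i\<in>{1..n}. 24 * ln (1 / \<delta>) < real i}. (5/6::real) ^ i)"
    by (intro sum_mono power_mono) auto
  \<comment> \<open>The upper end \<open>n + K\<close> keeps the range nonempty even if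
    \<open>K > n\<close>.\<close>
  also have "\<dots> \<le> (\<Sum>i\<in>{K..n + K}. (5/6) ^ i)"
    by (intro sum_mono2) (auto simp: K_def)
  also have "\<dots> \<le> 6 * (5/6) ^ K"
    by (subst sum_gp) (simp add: field_simps)
  also have "(5/6::real) ^ K \<le> \<delta> ^ 3"
  proof -
    have "exp 1 \<le> (6/5::real) ^ 8"
      using e_less_272 by (simp add: power_divide)
    then have "1 \<le> 8 * ln (6/5::real)"
      by (subst (asm) ln_ge_iff[symmetric]) (auto simp: ln_realpow)
    then have "24 * ln (1 / \<delta>) * (1 / 8) \<le> real K * ln (6/5)"
      using K assms by (intro mult_mono) auto
    then have "real K * ln (5/6) \<le> 3 * ln \<delta>"
      using assms by (simp add: ln_div algebra_simps)
    then have "ln ((5/6::real) ^ K) \<le> ln (\<delta> ^ 3)"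
      using assms by (simp add: ln_realpow)
    then show ?thesis
      using assms by (subst (asm) ln_le_cancel_iff) auto
  qed
  also have "6 * \<delta> ^ 3 \<le> 2 * \<delta>"
  proof -
    have "\<delta> * \<delta> \<le> 1/2 * (1/2)"
      using assms by (intro mult_mono) auto
    then have "\<delta> * (\<delta> * \<delta>) * 6 \<le> \<delta> * (1/2 * (1/2)) * 6"
      using assms by (intro mult_right_mono mult_left_mono) auto
    then show ?thesis
      using assms by (simp add: power3_eq_cube algebra_simps)
  qed
  finally show ?thesis by simp
qed


section \<open>Probability of a good sample\<close>

theorem theorem8:
  fixes \<mu> :: "(real ^ 'd) measure" and \<X> :: "(real ^ 'd) set" and q :: "real ^ 'd"
    and d\<^sub>o \<delta> :: real and n :: nat
  assumes "continuous_distribution \<mu>"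
    and "doubling_measure \<mu> d\<^sub>o \<X>"
    and "d\<^sub>o \<ge> 2"
    and "q \<in> \<X>"
    and "0 < \<delta>" and "\<delta> < 1/2"
  shows "measure (Pi\<^sub>M {1..n} (\<lambda>_. \<mu>))
           {x \<in> space (Pi\<^sub>M {1..n} (\<lambda>_. \<mu>)).
              \<forall>m. 2 \<le> m \<and> m \<le> n \<longrightarrow>
                \<Phi> m q (map x [1..<n + 1]) \<le> 6 * (2 / real m * ln (1 / \<delta>)) powr (1 / d\<^sub>o)}
         \<ge> 1 - 3 * \<delta>"
proof -
  have sets_\<mu> [measurable_cong]: "sets \<mu> = sets borel" and prob_\<mu>: "prob_space \<mu>"
    using assms(1) by (auto simp: continuous_distribution_def)
  interpret \<mu>: prob_space \<mu> by fact
  define P where "P = Pi\<^sub>M {1..n} (\<lambda>_. \<mu>)"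
  interpret P: prob_space P
    unfolding P_def by (intro prob_space_PiM prob_\<mu>)
  define L where "L = ln (1 / \<delta>)"
  have "L > 0" and exp_L: "exp (- L) = \<delta>"
    using assms by (auto simp: L_def ln_div)
  define R where "R x i = norm (q - nth_nearest q (map x [1..<n + 1]) i)" for x :: "nat \<Rightarrow> real ^ 'd" and i
  define good where "good = {x \<in> space P. \<forall>m. 2 \<le> m \<and> m \<le> n \<longrightarrow>
                \<Phi> m q (map x [1..<n + 1]) \<le> 6 * (2 / real m * ln (1 / \<delta>)) powr (1 / d\<^sub>o)}"
  have good_iff: "x \<in> good \<longleftrightarrow> x \<in> space P \<and> (\<forall>m\<in>{2..n}.
      1 / real m * (\<Sum>i=2..m. R x 1 / R x i) \<le> 6 * (2 * L / real m) powr (1 / d\<^sub>o))" for x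
    by (auto simp: good_def \<Phi>_def R_def L_def simp del: upt_Suc upt.simps)
  have [measurable]: "(\<lambda>x. R x i) \<in> borel_measurable P" if "i \<in> {1..n}" for i
    unfolding R_def P_def using that by (intro borel_measurable_norm_nth_nearest sets_\<mu>) auto
  have sets_good: "good \<in> sets P"
  proof -
    have "(\<lambda>x. 1 / real m * (\<Sum>i=2..m. R x 1 / R x i)) \<in> borel_measurable P" if "m \<in> {2..n}" for m
      using that
      by (intro borel_measurable_times borel_measurable_const borel_measurable_sum
          borel_measurable_divide) auto
    then have "{x \<in> space P. \<forall>m\<in>{2..n}.
        1 / real m * (\<Sum>i=2..m. R x 1 / R x i) \<le> 6 * (2 * L / real m) powr (1 / d\<^sub>o)} \<in> sets P"
      by (intro sets.sets_Collect_finite_All borel_measurable_le borel_measurable_const) auto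
    also have "{x \<in> space P. \<forall>m\<in>{2..n}.
        1 / real m * (\<Sum>i=2..m. R x 1 / R x i) \<le> 6 * (2 * L / real m) powr (1 / d\<^sub>o)} = good"
      unfolding set_eq_iff good_iff by simp
    finally show ?thesis .
  qed
  have R_le_iff: "R x i \<le> t \<longleftrightarrow> i \<le> card {j \<in> {1..n}. norm (q - x j) \<le> t}" if "i \<in> {1..n}" for x i t
    unfolding R_def using that by (intro norm_nth_nearest_le_iff) auto
  have R_nonneg: "R x i \<ge> 0" for x i
    by (simp add: R_def)
  have R_1_le: "R x 1 \<le> R x i" if "i \<in> {1..n}" for x i
    using R_le_iff[OF that, of x "R x i"] R_le_iff[of 1 x "R x i"] that by simp
  \<comment> \<open>The probabilistic part only has to control the ratios with
    \<open>i > 24 * L\<close>.\<close>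
  have goodI: "x \<in> good" if "x \<in> space P"
    and ratio: "\<And>i. i \<in> {2..n} \<Longrightarrow> 24 * L < real i
      \<Longrightarrow> R x 1 / R x i \<le> 2 * (2 * L / real i) powr (1 / d\<^sub>o)" for x
    unfolding good_iff
  proof (intro conjI ballI average_ratio_bound)
    fix m i assume "m \<in> {2..n}" "i \<in> {2..m}"
    then show "R x 1 \<le> R x i"
      by (intro R_1_le) auto
  qed (use assms that \<open>L > 0\<close> R_nonneg in auto)
  have "1 - measure P good \<le> 3 * \<delta>"
  \<comment> \<open>If \<open>n \<le> L\<close>, no index exceeds \<open>24 * L\<close> and every
    sample is good. Otherwise \<open>L / n < 1\<close> is an admissible quantile level.\<close>
  proof (cases "real n \<le> L")
    case True
    then have "space P \<subseteq> good"
      using \<open>L > 0\<close> by (intro subsetI goodI) auto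
    then have "good = space P"
      using sets.sets_into_space[OF sets_good] by auto
    then have "measure P good = 1"
      using P.prob_space by simp
    then show ?thesis
      using assms by simp
  next
    case False
    then have "n > 0"
      using \<open>L > 0\<close> by (intro gr0I) auto
    obtain s where s: "measure \<mu> (ball q s) \<le> L / real n" "L / real n \<le> measure \<mu> (cball q s)"
      using quantile_radius[OF prob_\<mu> sets_\<mu>, of "L / real n" q] \<open>L > 0\<close> \<open>n > 0\<close> False
      by (auto simp: field_simps)
    have "\<exists>r. measure \<mu> (ball q r) \<le> real i / (2 * real n) \<and> real i / (2 * real n) \<le> measure \<mu> (cball q r)"
      if "i \<in> {1..n}" for i
      using quantile_radius[OF prob_\<mu> sets_\<mu>, of "real i / (2 * real n)" q] that
      by (auto simp: field_simps)
    then obtain r where r: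
      "\<And>i. i \<in> {1..n} \<Longrightarrow> measure \<mu> (ball q (r i)) \<le> real i / (2 * real n)"
      "\<And>i. i \<in> {1..n} \<Longrightarrow> real i / (2 * real n) \<le> measure \<mu> (cball q (r i))"
      by metis
    define far where "far = {x \<in> space P. \<forall>j\<in>{1..n}. x j \<notin> cball q s}"
    define near where "near i = {x \<in> space P. i \<le> card {j \<in> {1..n}. x j \<in> ball q (r i)}}" for i
    define I where "I = {i \<in> {1..n}. 24 * L < real i}"
    have sets_far: "far \<in> sets P"
      unfolding far_def P_def mem_cball by measurable
    have sets_near: "near i \<in> sets P" for i
    proof -
      have "real (card {j \<in> {1..n}. x j \<in> ball q (r i)})
          = (\<Sum>j\<in>{1..n}. if x j \<in> ball q (r i) then 1 else 0)" for x
        by (simp add: sum.If_cases Int_def)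
      then have "near i = {x \<in> space P. real i \<le> (\<Sum>j\<in>{1..n}. if x j \<in> ball q (r i) then 1 else 0)}"
        by (simp only: near_def flip: of_nat_le_iff[where 'a = real])
      also have "\<dots> \<in> sets P"
        unfolding P_def mem_ball by measurable
      finally show ?thesis .
    qed
    have prob_far: "measure P far \<le> \<delta>"
    proof -
      have "measure P far \<le> exp (- (real (card {1..n}) * measure \<mu> (cball q s)))"
        unfolding far_def P_def by (intro prob_none_in prob_\<mu>) (auto simp: sets_\<mu>)
      also have "\<dots> \<le> exp (- L)"
        using s(2) \<open>n > 0\<close> by (simp add: field_simps)
      finally show ?thesis
        by (simp add: exp_L)
    qed
    have prob_near: "measure P (near i) \<le> (exp (1/2) / 2) ^ i" if "i \<in> {1..n}" for i
    proof -
      have "measure P (near i) \<le> exp (real (card {1..n}) * measure \<mu> (ball q (r i))) / 2 ^ i"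
        unfolding near_def P_def by (intro prob_count_ge prob_\<mu>) (auto simp: sets_\<mu>)
      also have "\<dots> \<le> exp (real i * (1/2)) / 2 ^ i"
        using r(1)[OF that] \<open>n > 0\<close> by (intro divide_right_mono) (auto simp: field_simps)
      finally show ?thesis
        by (simp only: exp_of_nat_mult power_divide)
    qed
    have "space P - good \<subseteq> far \<union> (\<Union>i\<in>I. near i)"
    proof (intro subsetI, rule ccontr)
      fix x assume x: "x \<in> space P - good" and not_bad: "x \<notin> far \<union> (\<Union>i\<in>I. near i)"
      have "R x 1 / R x i \<le> 2 * (2 * L / real i) powr (1 / d\<^sub>o)" if i: "i \<in> {2..n}" "24 * L < real i" for i
      \<comment> \<open>If \<open>q\<close> itself is sampled, the ratio is 0; otherwise both radii
        are positive and doubling applies.\<close>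
      proof (cases "R x 1 = 0")
        case False
        then have pos: "0 < R x 1" "R x 1 \<le> R x i"
          using R_nonneg[of x 1] R_1_le[of i x] i by auto
        from x not_bad obtain j where j: "j \<in> {1..n}" "norm (q - x j) \<le> s"
          by (auto simp: far_def dist_norm)
        then have "{j} \<subseteq> {j \<in> {1..n}. norm (q - x j) \<le> s}"
          by auto
        then have "card {j} \<le> card {j \<in> {1..n}. norm (q - x j) \<le> s}"
          by (intro card_mono) auto
        then have "R x 1 \<le> s"
          using \<open>n > 0\<close> by (subst R_le_iff) auto
        then have "measure \<mu> (ball q (R x 1)) \<le> measure \<mu> (ball q s)"
          by (intro \<mu>.finite_measure_mono) (auto simp: sets_\<mu>)
        then have near_1: "measure \<mu> (ball q (R x 1)) \<le> L / real n"
          using s(1) by simp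
        \<comment> \<open>Otherwise the at least \<open>i\<close> points within distance
          \<open>R x i\<close> would all lie in the open ball of radius \<open>r i\<close>, so
          \<open>near i\<close> would occur.\<close>
        have "r i \<le> R x i"
        proof (rule ccontr)
          assume "\<not> r i \<le> R x i"
          then have "{j \<in> {1..n}. norm (q - x j) \<le> R x i} \<subseteq> {j \<in> {1..n}. x j \<in> ball q (r i)}"
            by (auto simp: dist_norm)
          then have "card {j \<in> {1..n}. norm (q - x j) \<le> R x i} \<le> card {j \<in> {1..n}. x j \<in> ball q (r i)}"
            by (intro card_mono) auto
          moreover have "i \<le> card {j \<in> {1..n}. norm (q - x j) \<le> R x i}"
            using R_le_iff[of i x "R x i"] i by simp
          ultimately have "x \<in> near i"
            using x by (simp add: near_def)
          then show False
            using not_bad i by (auto simp: I_def)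
        qed
        then have "measure \<mu> (cball q (r i)) \<le> measure \<mu> (cball q (R x i))"
          by (intro \<mu>.finite_measure_mono) (auto simp: sets_\<mu>)
        then have far_i: "real i / (2 * real n) \<le> measure \<mu> (cball q (R x i))"
          using r(2)[of i] i by simp
        have "real i / (2 * real n) * (R x 1 / R x i) powr d\<^sub>o
            \<le> measure \<mu> (cball q (R x i)) * (R x 1 / R x i) powr d\<^sub>o"
          using far_i by (intro mult_right_mono) auto
        also have "\<dots> \<le> 2 powr d\<^sub>o * measure \<mu> (ball q (R x 1))"
          using assms pos sets_\<mu>
          by (intro doubling_ratio_bound[of _ _ \<X>] \<mu>.finite_measure_axioms) auto
        also have "\<dots> \<le> 2 powr d\<^sub>o * (L / real n)"
          using near_1 by (intro mult_left_mono) auto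
        finally have "(R x 1 / R x i) powr d\<^sub>o \<le> 2 powr d\<^sub>o * (2 * L / real i)"
          using \<open>n > 0\<close> i by (simp add: field_simps)
        then have "((R x 1 / R x i) powr d\<^sub>o) powr (1 / d\<^sub>o)
            \<le> (2 powr d\<^sub>o * (2 * L / real i)) powr (1 / d\<^sub>o)"
          using assms by (intro powr_mono2) auto
        also have "((R x 1 / R x i) powr d\<^sub>o) powr (1 / d\<^sub>o) = R x 1 / R x i"
          using assms pos by (simp add: powr_powr)
        also have "(2 powr d\<^sub>o * (2 * L / real i)) powr (1 / d\<^sub>o) = 2 * (2 * L / real i) powr (1 / d\<^sub>o)"
          using assms \<open>L > 0\<close> by (subst powr_mult) (simp_all add: powr_powr)
        finally show ?thesis .
      qed simp
      with x goodI show False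
        by auto
    qed
    \<comment> \<open>Union bound: \<open>far\<close> costs \<open>\<delta>\<close>, and the events
      \<open>near i\<close> together cost \<open>2 * \<delta>\<close>.\<close>
    then have "measure P (space P - good) \<le> measure P (far \<union> (\<Union>i\<in>I. near i))"
      using sets_far sets_near
      by (intro P.finite_measure_mono sets.Un sets.finite_UN) (auto simp: I_def)
    also have "\<dots> \<le> measure P far + measure P (\<Union>i\<in>I. near i)"
      using sets_far sets_near
      by (intro measure_Un_le sets.finite_UN) (auto simp: I_def)
    also have "measure P (\<Union>i\<in>I. near i) \<le> (\<Sum>i\<in>I. measure P (near i))"
      using sets_near by (intro measure_UNION_le) (auto simp: I_def)
    also have "\<dots> \<le> (\<Sum>i\<in>I. (exp (1/2) / 2) ^ i)"
      by (intro sum_mono prob_near) (auto simp: I_def)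
    also have "\<dots> \<le> 2 * \<delta>"
      unfolding I_def L_def using assms by (intro geometric_tail_bound)
    finally have "measure P (space P - good) \<le> 3 * \<delta>"
      using prob_far by simp
    then show ?thesis
      using P.prob_compl[OF sets_good] by simp
  qed
  then show ?thesis
    unfolding good_def P_def by linarith
qed

end
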